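(* Let $A\in\mathbb{P}(2n)$ and $1\le j\le n$ be such that $d_j(A)$ is simple. Let $U$ be a neighbourhood of $A$ in $\mathbb{P}(2n)$ on which $d_j$ is infinitely differentiable and $d_j(P)$ is simple for every $P\in U$, and let $u_j,v_j:U\to\mathbb{R}^{2n}$ be infinitely differentiable maps such that for all $P\in U$ the pair $(u_j(P),v_j(P))$ is a normalised symplectic eigenvector pair of $P$ corresponding to $d_j(P)$ and $\langle u_j(A),Ju_j(P)\rangle+\langle v_j(A),Jv_j(P)\rangle=0$. Let $M$ be any symplectic matrix with $M^TAM=\begin{bmatrix}D&O\\O&D\end{bmatrix}$, $D=\mathrm{diag}(d_1(A),\dots,d_n(A))$. Then for every $2n\times2n$ real symmetric matrix $B$ the derivatives of $d_j,u_j,v_j$ at $A$ in the direction $B$ are $$Dd_j(A)(B)=\frac{\langle u_j(A),Bu_j(A)\rangle+\langle v_j(A),Bv_j(A)\rangle}{2},$$ $$Du_j(A)(B)=M\hat{D}M^TBu_j(A)+M\overline{D}JM^TBv_j(A),$$ $$Dv_j(A)(B)=M\hat{D}M^TBv_j(A)-M\overline{D}JM^TBu_j(A),$$ where $\hat D$ and $\overline D$ are the $2n\times2n$ diagonal matrices with entries, for $1\le k\le n$, $$(\hat D)_{kk}=(\hat D)_{n+k,n+k}=\begin{cases}\dfrac{d_k(A)}{d_j^2(A)-d_k^2(A)} & k\ne j\\[2mm] -\dfrac{1}{4d_j(A)} & k=j,\end{cases}\qquad (\overline D)_{kk}=(\overline D)_{n+k,n+k}=\begin{cases}\dfrac{d_j(A)}{d_j^2(A)-d_k^2(A)}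 & k\ne j\\[2mm] \dfrac{1}{4d_j(A)} & k=j.\end{cases}$$
   Context: Let $J=\begin{bmatrix}O & I_n\\ -I_n & O\end{bmatrix}$ ($2n\times 2n$). A real $2n\times 2n$ matrix $M$ is symplectic if $M^TJM=J$. $\mathbb{P}(2n)$ denotes the set of $2n\times 2n$ real symmetric positive definite matrices (an open subset of the space of real symmetric matrices). By Williamson's theorem, for every $A\in\mathbb{P}(2n)$ there is a symplectic $M$ with $M^TAM=\begin{bmatrix}D&O\\O&D\end{bmatrix}$, $D=\mathrm{diag}(d_1(A),\dots,d_n(A))$, where $0<d_1(A)\le\dots\le d_n(A)$ are uniquely determined by $A$; they are the symplectic eigenvalues of $A$. A symplectic eigenvalue $d$ of $A$ is simple if $\{i: d_i(A)=d\}$ has exactly one element. $\langle\cdot,\cdot\rangle$ is the Euclidean inner product. A pair $(u,v)$ of vectors in $\mathbb{R}^{2n}$ is a symplectic eigenvector pair of $A$ corresponding to $d$ if $Au=dJv$ and $Av=-dJu$; it is normalised if $\langle u,Jv\rangle=1$. When $d_j(A)$ is simple, a neighbourhood $U$ and maps $u_j,v_j$ as in the statement exist (through any given normalised symplectic eigenvector pair $(u_j(A),v_j(A))$ of $A$ corresponding to $d_j(A)$). *)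

theory Defs
  imports "HOL-Analysis.Analysis"
begin

text \<open>
  The coordinates 1, ..., n are the elements of a finite linearly ordered type \<open>'n\<close> with
  \<open>n = CARD('n)\<close>, and the coordinates 1, ..., 2n are the elements of \<open>'n + 'n\<close>: \<open>Inl k\<close> is the
  coordinate k and \<open>Inr k\<close> is the coordinate n + k.
\<close>

type_synonym 'n vec2n = "real ^ ('n + 'n)"
type_synonym 'n mat2n = "real ^ ('n + 'n) ^ ('n + 'n)"

definition J :: "'n::finite mat2n" where
  "J = (\<chi> a b. case (a, b) of
      (Inl i, Inr k) \<Rightarrow> if i = k then 1 else 0
    | (Inr i, Inl k) \<Rightarrow> if i = k then -1 else 0
    | _ \<Rightarrow> 0)"

definition double_diag :: "('n::finite \<Rightarrow> real) \<Rightarrow> 'n mat2n" where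
  "double_diag d = (\<chi> a b. if a = b then (case a of Inl k \<Rightarrow> d k | Inr k \<Rightarrow> d k) else 0)"

definition symplectic :: "'n::finite mat2n \<Rightarrow> bool" where
  "symplectic M \<longleftrightarrow> transpose M ** J ** M = J"

definition symmetric_matrices :: "(real ^ 'm ^ 'm) set" where
  "symmetric_matrices = {A. transpose A = A}"

definition pos_def_matrices :: "(real ^ 'm::finite ^ 'm) set" where
  "pos_def_matrices = {A \<in> symmetric_matrices. \<forall>x. x \<noteq> 0 \<longrightarrow> 0 < x \<bullet> (A *v x)}"

text \<open>
  By Williamson's theorem the description below determines a unique function when \<open>A\<close> is
  symmetric positive definite; for other \<open>A\<close> the value is irrelevant.
\<close>

definition symp_eigenvalue :: "'n::{finite,linorder} mat2n \<Rightarrow> 'n \<Rightarrow> real" where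
  "symp_eigenvalue A = (THE d. mono d \<and> (\<forall>k. 0 < d k) \<and>
     (\<exists>M. symplectic M \<and> transpose M ** A ** M = double_diag d))"

definition simple_symp_eigenvalue :: "'n::{finite,linorder} mat2n \<Rightarrow> real \<Rightarrow> bool" where
  "simple_symp_eigenvalue A d \<longleftrightarrow> card {i. symp_eigenvalue A i = d} = 1"

definition symp_eigenvector_pair ::
    "'n::finite mat2n \<Rightarrow> real \<Rightarrow> 'n vec2n \<Rightarrow> 'n vec2n \<Rightarrow> bool" where
  "symp_eigenvector_pair A d u v \<longleftrightarrow> A *v u = d *\<^sub>R (J *v v) \<and> A *v v = - d *\<^sub>R (J *v u)"

definition normalised_symp_eigenvector_pair ::
    "'n::finite mat2n \<Rightarrow> real \<Rightarrow> 'n vec2n \<Rightarrow> 'n vec2n \<Rightarrow> bool" where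
  "normalised_symp_eigenvector_pair A d u v \<longleftrightarrow>
     symp_eigenvector_pair A d u v \<and> u \<bullet> (J *v v) = 1"

text \<open>
  Differentiability of order \<open>k\<close> for a map on a relatively open subset \<open>U\<close> of a linear subspace
  \<open>V\<close>. The derivative within \<open>U\<close> is determined only on \<open>V\<close>, so the higher derivatives are taken
  in directions \<open>h \<in> V\<close> only.
\<close>

primrec times_cont_differentiable_on ::
    "nat \<Rightarrow> 'a::real_normed_vector set \<Rightarrow> 'a set \<Rightarrow> ('a \<Rightarrow> 'b::real_normed_vector) \<Rightarrow> bool" where
  "times_cont_differentiable_on 0 V U f \<longleftrightarrow> continuous_on U f"
| "times_cont_differentiable_on (Suc k) V U f \<longleftrightarrow>
     (\<exists>f'. (\<forall>x\<in>U. (f has_derivative f' x) (at x within U)) \<and>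
           (\<forall>h\<in>V. times_cont_differentiable_on k V U (\<lambda>x. f' x h)))"

definition infinitely_differentiable_on ::
    "'a::real_normed_vector set \<Rightarrow> 'a set \<Rightarrow> ('a \<Rightarrow> 'b::real_normed_vector) \<Rightarrow> bool" where
  "infinitely_differentiable_on V U f \<longleftrightarrow> (\<forall>k. times_cont_differentiable_on k V U f)"

end

(*
  Every P in U satisfies P u = d J v, P v = - d J u, <u, J v> = 1 and the gauge condition
  <u(A), J u> + <v(A), J v> = 0.  Differentiating these four identities at A along a segment
  t -> A + t B and writing all vectors in the symplectic basis M decouples the resulting linear
  system into blocks indexed by k: for k ~= j the block is invertible because d_j^2 ~= d_k^2,
  and for k = j the normalisation and the gauge condition supply the two missing equations.
*)

theory Submission
  imports Defs
begin

declare transpose_matrix_vector [simp del]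

section \<open>Block coordinates, and the action of \<open>J\<close> and of block-diagonal
  matrices\<close>

lemma sum_vec_eq_iff:
  "x = y \<longleftrightarrow> (\<forall>k. x $ Inl k = y $ Inl k \<and> x $ Inr k = y $ Inr k)"
  for x y :: "real ^ ('n::finite + 'n)"
  by (auto simp: vec_eq_iff split_sum_all)

lemma inner_sum_vec:
  "x \<bullet> y = (\<Sum>k\<in>UNIV. x $ Inl k * y $ Inl k) + (\<Sum>k\<in>UNIV. x $ Inr k * y $ Inr k)"
  for x y :: "real ^ ('n::finite + 'n)"
  unfolding inner_vec_def inner_real_def
  by (simp flip: UNIV_Plus_UNIV add: sum.Plus)

lemma J_vec [simp]:
  "(J *v x) $ Inl k = x $ Inr k" "(J *v x) $ Inr k = - x $ Inl k"
  by (simp_all add: matrix_vector_mult_def J_def sum.Plus if_distrib[of "\<lambda>c. c * _"]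
      flip: UNIV_Plus_UNIV cong: if_cong)

lemma double_diag_vec [simp]:
  "(double_diag d *v x) $ Inl k = d k * x $ Inl k"
  "(double_diag d *v x) $ Inr k = d k * x $ Inr k"
  by (simp_all add: matrix_vector_mult_def double_diag_def if_distrib[of "\<lambda>c. c * _"]
      cong: if_cong)

lemma J_J_vec [simp]: "J *v (J *v x) = - x"
  by (simp add: sum_vec_eq_iff)

lemma inner_matrix_transpose: "(M *v x) \<bullet> y = x \<bullet> (transpose M *v y)" for M :: "real ^ 'n ^ 'm"
  by (metis dot_lmul_matrix inner_commute transpose_matrix_vector)

section \<open>Symplectic matrices as changes of coordinates\<close>

lemma symplectic_transpose_J:
  "symplectic M \<Longrightarrow> transpose M *v (J *v (M *v x)) = J *v x"
  by (simp add: symplectic_def matrix_vector_mul_assoc matrix_mul_assoc)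

text \<open>\<open>M *v x\<close> determines \<open>J *v x\<close>, hence \<open>x\<close>, so the
  square matrix \<open>M\<close> is injective and therefore onto. This is what allows any vector to
  be written in the symplectic basis formed by the columns of \<open>M\<close>.\<close>

lemma symplectic_surj:
  assumes "symplectic M"
  obtains x where "y = M *v x"
proof -
  have "inj ((*v) M)"
    unfolding inj_def
  proof safe
    fix x x' assume "M *v x = M *v x'"
    then have "J *v x = J *v x'"
      by (metis assms symplectic_transpose_J)
    then show "x = x'"
      by (metis J_J_vec neg_equal_iff_equal)
  qed
  then have "surj ((*v) M)"
    by (simp add: linear_injective_imp_surjective)
  then show thesis
    using that by (metis surj_def)
qed

lemma symplectic_inj_zero:
  assumes "symplectic M" "M *v x = 0"
  shows "x = 0"
proof -
  have "J *v x = 0"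
    using symplectic_transpose_J[OF assms(1), of x] assms(2) by simp
  then show ?thesis
    by (metis J_J_vec matrix_vector_mult_0_right neg_equal_0_iff_equal)
qed

text \<open>The entry \<open>d k\<close> is the value of the quadratic form of \<open>A\<close> at
  the column of \<open>M\<close> with index \<open>Inl k\<close>, which is nonzero by injectivity.
  Positivity is thus read off from the diagonalisation itself.\<close>

lemma williamson_diagonal_pos:
  assumes "A \<in> pos_def_matrices" "symplectic M" "transpose M ** A ** M = double_diag d"
  shows "0 < d k"
proof -
  let ?e = "axis (Inl k) 1 :: 'a vec2n"
  have "M *v ?e \<noteq> 0"
    using symplectic_inj_zero[OF assms(2), of ?e] by auto
  then have "0 < (M *v ?e) \<bullet> (A *v (M *v ?e))"
    using assms(1) by (simp add: pos_def_matrices_def)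
  also have "\<dots> = ?e \<bullet> (double_diag d *v ?e)"
    by (simp add: inner_matrix_transpose matrix_vector_mul_assoc matrix_mul_assoc flip: assms(3))
  also have "\<dots> = d k"
    by (simp add: inner_axis')
  finally show ?thesis .
qed

section \<open>Short segments in symmetric directions stay in the open set\<close>

lemma pos_def_coercive:
  fixes A :: "real ^ 'n ^ 'n"
  assumes "A \<in> pos_def_matrices"
  obtains c where "0 < c" "\<And>x. c * (norm x)\<^sup>2 \<le> x \<bullet> (A *v x)"
proof -
  let ?S = "sphere 0 1 :: (real ^ 'n) set"
  have "axis undefined 1 \<in> ?S"
    by simp
  then have "?S \<noteq> {}"
    by blast
  moreover have "continuous_on ?S (\<lambda>x. x \<bullet> (A *v x))"
    by (intro continuous_intros linear_continuous_on matrix_vector_mul_bounded_linear)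
  \<comment> \<open>The minimum of the form on the compact unit sphere is the constant
    \<open>c\<close>; homogeneity of degree two carries the bound to all vectors.\<close>
  ultimately obtain z where z: "z \<in> ?S" "\<And>y. y \<in> ?S \<Longrightarrow> z \<bullet> (A *v z) \<le> y \<bullet> (A *v y)"
    using continuous_attains_inf[OF compact_sphere] by blast
  show thesis
  proof
    have "z \<noteq> 0"
      using z(1) by auto
    then show "0 < z \<bullet> (A *v z)"
      using assms by (simp add: pos_def_matrices_def)
    show "z \<bullet> (A *v z) * (norm x)\<^sup>2 \<le> x \<bullet> (A *v x)" for x
    proof (cases "x = 0")
      case False
      then have "z \<bullet> (A *v z) \<le> (x /\<^sub>R norm x) \<bullet> (A *v (x /\<^sub>R norm x))"
        by (intro z(2)) simp
      also have "\<dots> = (x \<bullet> (A *v x)) / (norm x)\<^sup>2"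
        by (simp add: matrix_vector_mult_scaleR power2_eq_square divide_simps)
      finally show ?thesis
        using False by (simp add: field_simps)
    qed simp
  qed
qed

text \<open>The perturbation changes the form at \<open>x\<close> by at most
  \<open>\<bar>t\<bar> * K * (norm x)\<^sup>2\<close>, with \<open>K\<close> a bound for the
  operator \<open>B\<close>, and coercivity of \<open>A\<close> absorbs this as long as
  \<open>\<bar>t\<bar> < c / K\<close>.\<close>

lemma pos_def_add_small:
  fixes A B :: "real ^ 'n ^ 'n"
  assumes A: "A \<in> pos_def_matrices" and B: "B \<in> symmetric_matrices"
  obtains e where "0 < e" "\<And>t. \<bar>t\<bar> < e \<Longrightarrow> A + t *\<^sub>R B \<in> pos_def_matrices"
proof -
  obtain c where c: "0 < c" "\<And>x. c * (norm x)\<^sup>2 \<le> x \<bullet> (A *v x)"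
    using pos_def_coercive[OF A] by blast
  obtain K where K: "0 < K" "\<And>x. norm (B *v x) \<le> norm x * K"
    using bounded_linear.pos_bounded[OF matrix_vector_mul_bounded_linear[of B]] by blast
  show thesis
  proof
    show "0 < c / K"
      using c K by simp
    fix t :: real assume t: "\<bar>t\<bar> < c / K"
    have "A + t *\<^sub>R B \<in> symmetric_matrices"
      using A B by (simp add: pos_def_matrices_def symmetric_matrices_def transpose_def vec_eq_iff)
    moreover have "0 < x \<bullet> ((A + t *\<^sub>R B) *v x)" if "x \<noteq> 0" for x
    proof -
      have "\<bar>x \<bullet> (B *v x)\<bar> \<le> norm x * (norm x * K)"
        by (meson Cauchy_Schwarz_ineq2 K(2) mult_left_mono norm_ge_zero order_trans)
      then have "\<bar>t * (x \<bullet> (B *v x))\<bar> \<le> \<bar>t\<bar> * (K * (norm x)\<^sup>2)"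
        using mult_left_mono[of _ _ "\<bar>t\<bar>"] by (fastforce simp: abs_mult power2_eq_square mult_ac)
      also have "\<dots> < c * (norm x)\<^sup>2"
        using t K(1) that by (simp add: field_simps)
      finally have "0 < c * (norm x)\<^sup>2 + t * (x \<bullet> (B *v x))"
        by linarith
      also have "\<dots> \<le> x \<bullet> (A *v x) + t * (x \<bullet> (B *v x))"
        using c(2) by simp
      finally show ?thesis
        by (simp add: matrix_vector_mult_add_rdistrib inner_add_right
            flip: scaleR_matrix_vector_assoc)
    qed
    ultimately show "A + t *\<^sub>R B \<in> pos_def_matrices"
      by (simp add: pos_def_matrices_def)
  qed
qed

text \<open>\<open>U\<close> is open only relative to the positive definite matrices, so two bounds
  on \<open>t\<close> are combined: one keeps the segment positive definite, the other keeps it in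
  an ambient open set cutting out \<open>U\<close>.\<close>

lemma segment_in_open:
  fixes A B :: "real ^ 'n ^ 'n"
  assumes U: "openin (top_of_set pos_def_matrices) U" "A \<in> U" and B: "B \<in> symmetric_matrices"
  obtains e where "0 < e" "\<And>t. t \<in> {0..e} \<Longrightarrow> A + t *\<^sub>R B \<in> U"
proof -
  obtain T where T: "open T" "U = pos_def_matrices \<inter> T"
    using U(1) by (auto simp: openin_open)
  then obtain e1 where e1: "0 < e1" "\<And>t. \<bar>t\<bar> < e1 \<Longrightarrow> A + t *\<^sub>R B \<in> pos_def_matrices"
    using pos_def_add_small[of A B] U(2) B by blast
  have "((\<lambda>t. A + t *\<^sub>R B) \<longlongrightarrow> A + 0 *\<^sub>R B) (at 0)"
    by (intro tendsto_intros)
  then have "\<forall>\<^sub>F t in at 0. A + t *\<^sub>R B \<in> T"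
    using T U(2) by (auto dest: topological_tendstoD)
  then obtain e2 where e2: "0 < e2" "\<And>t. t \<noteq> 0 \<Longrightarrow> \<bar>t\<bar> < e2 \<Longrightarrow> A + t *\<^sub>R B \<in> T"
    by (auto simp: eventually_at)
  show thesis
  proof
    \<comment> \<open>Both bounds are strict while the segment is closed, hence the half.\<close>
    show "0 < min e1 e2 / 2"
      using e1 e2 by simp
    fix t assume "t \<in> {0..min e1 e2 / 2}"
    then have "\<bar>t\<bar> < e1" "\<bar>t\<bar> < e2"
      using e1(1) e2(1) by auto
    then show "A + t *\<^sub>R B \<in> U"
      using e1(2) e2(2) U(2) T(2) by (cases "t = 0") auto
  qed
qed

text \<open>This turns an identity valid on \<open>U\<close> into a linear equation for directional
  derivatives. Since \<open>U\<close> lies in the space of symmetric matrices, a derivative within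
  \<open>U\<close> is determined only in symmetric directions. Restricting to a segment from
  \<open>A\<close> reduces the claim to uniqueness of a one-sided derivative in one real
  variable.\<close>

lemma derivative_const_symmetric_direction:
  fixes A B :: "real ^ 'n ^ 'n" and F :: "real ^ 'n ^ 'n \<Rightarrow> 'b::real_normed_vector"
  assumes F: "(F has_derivative F') (at A within U)"
    and const: "\<And>P. P \<in> U \<Longrightarrow> F P = c"
    and U: "openin (top_of_set pos_def_matrices) U" "A \<in> U" and B: "B \<in> symmetric_matrices"
  shows "F' B = 0"
proof -
  obtain e where e: "0 < e" "\<And>t. t \<in> {0..e} \<Longrightarrow> A + t *\<^sub>R B \<in> U"
    using segment_in_open[OF U B] by blast
  have "((\<lambda>t. A + t *\<^sub>R B) has_derivative (\<lambda>t. t *\<^sub>R B)) (at 0 within {0..e})"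
    by (auto intro!: derivative_eq_intros)
  moreover have "(F has_derivative F') (at (A + 0 *\<^sub>R B) within (\<lambda>t. A + t *\<^sub>R B) ` {0..e})"
    using has_derivative_subset[OF F, of "(\<lambda>t. A + t *\<^sub>R B) ` {0..e}"] e(2)
    by (simp add: image_subset_iff)
  ultimately have "((\<lambda>t. F (A + t *\<^sub>R B)) has_derivative (\<lambda>t. F' (t *\<^sub>R B))) (at 0 within {0..e})"
    by (rule has_derivative_in_compose)
  then have "((\<lambda>t. F (A + t *\<^sub>R B)) has_vector_derivative F' B) (at 0 within {0..e})"
    by (simp add: has_vector_derivative_def
        linear_scale[OF bounded_linear.linear[OF has_derivative_bounded_linear[OF F]]])
  then have "((\<lambda>t. c) has_vector_derivative F' B) (at 0 within {0..e})"
    by (rule has_vector_derivative_transform[rotated 2]) (use e const in auto)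
  then show ?thesis
    using vector_derivative_unique_within[of 0 "{0..e}" "\<lambda>t. c"] e(1)
    by (force simp: trivial_limit_within)
qed

text \<open>Supplies the product rule for \<open>P *v u P\<close>, where matrix and vector both
  vary.\<close>

lemma bounded_bilinear_matrix_vector:
  "bounded_bilinear ((*v) :: real ^ 'n ^ 'm \<Rightarrow> _)"
  unfolding bilinear_conv_bounded_bilinear[symmetric] bilinear_def
  by (intro conjI allI linearI)
     (simp_all add: matrix_vector_mult_add_rdistrib matrix_vector_right_distrib
        matrix_vector_mult_scaleR scaleR_matrix_vector_assoc)

lemmas has_derivative_matrix_vector =
  bounded_bilinear.FDERIV[OF bounded_bilinear_matrix_vector]

lemmas has_derivative_matrix_const =
  bounded_linear.has_derivative[OF matrix_vector_mul_bounded_linear]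

section \<open>The linearised system in diagonal coordinates\<close>

lemma diagonal_pair_support:
  fixes d :: "'n::finite \<Rightarrow> real" and x y :: "'n vec2n"
  assumes dpos: "\<And>k. 0 < d k" and dj: "\<forall>k. k \<noteq> j \<longrightarrow> d k \<noteq> d j"
    and x: "double_diag d *v x = d j *\<^sub>R (J *v y)"
    and y: "double_diag d *v y = - d j *\<^sub>R (J *v x)"
  shows "k \<noteq> j \<Longrightarrow> x $ Inl k = 0" "k \<noteq> j \<Longrightarrow> x $ Inr k = 0"
    and "k \<noteq> j \<Longrightarrow> y $ Inl k = 0" "k \<noteq> j \<Longrightarrow> y $ Inr k = 0"
    and "y $ Inl j = - x $ Inr j" "y $ Inr j = x $ Inl j"
proof -
  have eq: "d k * x $ Inl k = d j * y $ Inr k" "d k * x $ Inr k = - d j * y $ Inl k"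
    "d k * y $ Inl k = - d j * x $ Inr k" "d k * y $ Inr k = d j * x $ Inl k" for k
    using x y by (simp_all add: sum_vec_eq_iff)
  \<comment> \<open>Positivity excludes \<open>d k = - d j\<close>. Eliminating the partner
    coordinate from two of the equations \<open>eq\<close> then forces every coordinate outside
    block \<open>j\<close> to vanish.\<close>
  have sq: "(d k)\<^sup>2 \<noteq> (d j)\<^sup>2" if "k \<noteq> j" for k
    using dj that dpos[of k] dpos[of j] by (auto simp: power2_eq_iff)
  have *: "((d k)\<^sup>2 - (d j)\<^sup>2) * x $ Inl k = 0" "((d k)\<^sup>2 - (d j)\<^sup>2) * x $ Inr k = 0"
    "((d k)\<^sup>2 - (d j)\<^sup>2) * y $ Inl k = 0" "((d k)\<^sup>2 - (d j)\<^sup>2) * y $ Inr k = 0" for k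
    using eq[of k] by algebra+
  show "k \<noteq> j \<Longrightarrow> x $ Inl k = 0" "k \<noteq> j \<Longrightarrow> x $ Inr k = 0"
    "k \<noteq> j \<Longrightarrow> y $ Inl k = 0" "k \<noteq> j \<Longrightarrow> y $ Inr k = 0"
    using *[of k] sq[of k] by auto
  show "y $ Inl j = - x $ Inr j" "y $ Inr j = x $ Inl j"
    using eq(3)[of j] eq(2,4)[of j] dpos[of j] mult_left_cancel[of "d j" "y $ Inl j" "- x $ Inr j"]
    by auto
qed

lemma inner_supported:
  fixes x y :: "real ^ ('n::finite + 'n)"
  assumes "\<And>k. k \<noteq> j \<Longrightarrow> x $ Inl k = 0 \<and> x $ Inr k = 0"
  shows "x \<bullet> y = x $ Inl j * y $ Inl j + x $ Inr j * y $ Inr j"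
proof -
  have "(\<Sum>k\<in>UNIV. x $ c k * y $ c k) = x $ c j * y $ c j" if "c = Inl \<or> c = Inr" for c
    using sum.remove[of UNIV j "\<lambda>k. x $ c k * y $ c k"] assms that by auto
  then show ?thesis
    by (simp add: inner_sum_vec)
qed

text \<open>Here \<open>x\<close>, \<open>y\<close> are the coordinates of the eigenvector pair,
  \<open>p\<close>, \<open>q\<close> those of its derivatives, \<delta> is the derivative of the
  eigenvalue, and \<open>f\<close>, \<open>g\<close> carry the perturbation. The hypotheses
  \<open>dnorm\<close> and \<open>gauge\<close> are the differentiated normalisation and gauge
  condition.\<close>

lemma diagonal_perturbation:
  fixes d :: "'n::finite \<Rightarrow> real" and x y p q f g :: "'n vec2n"
  assumes dpos: "\<And>k. 0 < d k" and dj: "\<forall>k. k \<noteq> j \<longrightarrow> d k \<noteq> d j"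
    and x: "double_diag d *v x = d j *\<^sub>R (J *v y)"
    and y: "double_diag d *v y = - d j *\<^sub>R (J *v x)"
    and norm: "x \<bullet> (J *v y) = 1"
    and p: "double_diag d *v p + f = \<delta> *\<^sub>R (J *v y) + d j *\<^sub>R (J *v q)"
    and q: "double_diag d *v q + g = - (\<delta> *\<^sub>R (J *v x) + d j *\<^sub>R (J *v p))"
    and dnorm: "x \<bullet> (J *v q) + p \<bullet> (J *v y) = 0"
    and gauge: "x \<bullet> (J *v p) + y \<bullet> (J *v q) = 0"
  defines "Dhat \<equiv> double_diag
      (\<lambda>k. if k = j then - 1 / (4 * d j) else d k / ((d j)\<^sup>2 - (d k)\<^sup>2))"
    and "Dbar \<equiv> double_diag
      (\<lambda>k. if k = j then 1 / (4 * d j) else d j / ((d j)\<^sup>2 - (d k)\<^sup>2))"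
  shows "\<delta> = (x \<bullet> f + y \<bullet> g) / 2"
    and "p = Dhat *v f + Dbar *v (J *v g)"
    and "q = Dhat *v g - Dbar *v (J *v f)"
proof -
  note supp = diagonal_pair_support[OF dpos dj x y]
  \<comment> \<open>In block \<open>j\<close> the pair is \<open>x = (a, b)\<close>,
    \<open>y = (- b, a)\<close>, and normalisation makes \<open>(a, b)\<close> a unit
    vector.\<close>
  define a b where "a = x $ Inl j" and "b = x $ Inr j"
  have xj: "x $ Inl j = a" "x $ Inr j = b" "y $ Inl j = - b" "y $ Inr j = a"
    using supp(5,6) by (simp_all add: a_def b_def)
  have eq: "d k * p $ Inl k + f $ Inl k = \<delta> * y $ Inr k + d j * q $ Inr k"
    "d k * p $ Inr k + f $ Inr k = - \<delta> * y $ Inl k - d j * q $ Inl k"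
    "d k * q $ Inl k + g $ Inl k = - \<delta> * x $ Inr k - d j * p $ Inr k"
    "d k * q $ Inr k + g $ Inr k = \<delta> * x $ Inl k + d j * p $ Inl k" for k
    using p[unfolded sum_vec_eq_iff, THEN spec[of _ k]] q[unfolded sum_vec_eq_iff, THEN spec[of _ k]]
    by (simp_all add: algebra_simps)
  note eqj = eq[of j, unfolded xj]
  have inx: "x \<bullet> z = a * z $ Inl j + b * z $ Inr j" for z
    using inner_supported[of j x z] supp(1,2) by (simp add: xj)
  have iny: "y \<bullet> z = - b * z $ Inl j + a * z $ Inr j" for z
    using inner_supported[of j y z] supp(3,4) by (simp add: xj)
  have ab: "a * a + b * b = 1"
    using norm by (simp add: inx xj)
  have "p \<bullet> (J *v y) = (J *v y) \<bullet> p"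
    by (rule inner_commute)
  also have "\<dots> = a * p $ Inl j + b * p $ Inr j"
    using inner_supported[of j "J *v y" p] supp(3,4) by (simp add: xj)
  finally have n1: "a * (p $ Inl j + q $ Inr j) + b * (p $ Inr j - q $ Inl j) = 0"
    using dnorm by (simp add: inx algebra_simps)
  have n2: "a * (p $ Inr j - q $ Inl j) - b * (p $ Inl j + q $ Inr j) = 0"
    using gauge by (simp add: inx iny algebra_simps)
  \<comment> \<open>\<open>n1\<close> and \<open>n2\<close> say that the rotation given by
    \<open>(a, b)\<close> kills the vector with entries \<open>p $ Inl j + q $ Inr j\<close> and
    \<open>p $ Inr j - q $ Inl j\<close>, so that vector is zero.\<close>
  have q2: "q $ Inr j = - p $ Inl j" and q1: "q $ Inl j = p $ Inr j"
    using n1 n2 ab by algebra+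
  show "\<delta> = (x \<bullet> f + y \<bullet> g) / 2"
  proof -
    \<comment> \<open>Combining the equations of block \<open>j\<close> in pairs cancels
      \<open>p\<close> after the substitution of \<open>q\<close>; \<open>a * a + b * b = 1\<close>
      then isolates \<delta>.\<close>
    have "2 * (\<delta> * a) = f $ Inl j + g $ Inr j" "2 * (\<delta> * b) = f $ Inr j - g $ Inl j"
      using eqj by (simp_all add: q1 q2)
    then have "2 * \<delta> = a * f $ Inl j + b * f $ Inr j + (- b * g $ Inl j + a * g $ Inr j)"
      using ab by algebra
    then show ?thesis
      by (simp add: inx iny)
  qed
  \<comment> \<open>The opposite combination cancels \<delta> instead. Two equations contribute two
    terms in \<open>p\<close> each, which gives the factor 4 in the entries with
    \<open>k = j\<close>.\<close>
  have jj: "4 * d j * p $ Inl j = g $ Inr j - f $ Inl j"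
      "4 * d j * p $ Inr j = - f $ Inr j - g $ Inl j"
    using eqj by (simp_all add: q1 q2)
  have sq: "(d j)\<^sup>2 - (d k)\<^sup>2 \<noteq> 0" if "k \<noteq> j" for k
    using dj that dpos[of k] dpos[of j] by (auto simp: power2_eq_iff)
  \<comment> \<open>Outside block \<open>j\<close> the terms with \<delta> vanish, and
    \<open>p $ Inl k\<close> is coupled only to \<open>q $ Inr k\<close>, \<open>p $ Inr k\<close>
    only to \<open>q $ Inl k\<close>. Each pair solves a two by two system with determinant
    \<open>(d k)\<^sup>2 - (d j)\<^sup>2\<close>.\<close>
  have kk: "((d j)\<^sup>2 - (d k)\<^sup>2) * p $ Inl k = d k * f $ Inl k + d j * g $ Inr k"
      "((d j)\<^sup>2 - (d k)\<^sup>2) * p $ Inr k = d k * f $ Inr k - d j * g $ Inl k"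
      "((d j)\<^sup>2 - (d k)\<^sup>2) * q $ Inl k = d k * g $ Inl k - d j * f $ Inr k"
      "((d j)\<^sup>2 - (d k)\<^sup>2) * q $ Inr k = d k * g $ Inr k + d j * f $ Inl k" if "k \<noteq> j" for k
    using eq[of k] supp(1-4)[OF that] by algebra+
  have "p $ Inl k = (Dhat *v f + Dbar *v (J *v g)) $ Inl k"
    "p $ Inr k = (Dhat *v f + Dbar *v (J *v g)) $ Inr k"
    "q $ Inl k = (Dhat *v g - Dbar *v (J *v f)) $ Inl k"
    "q $ Inr k = (Dhat *v g - Dbar *v (J *v f)) $ Inr k" for k
  proof -
    \<comment> \<open>The entries of \<open>Dhat\<close> and \<open>Dbar\<close> at \<open>k\<close>
      are \<open>c / D\<close> and \<open>s / D\<close>, so \<open>jj\<close> and \<open>kk\<close>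
      take one common shape.\<close>
    define D where "D = (if k = j then 4 * d j else (d j)\<^sup>2 - (d k)\<^sup>2)"
    define c where "c = (if k = j then - 1 else d k)"
    define s where "s = (if k = j then 1 else d j)"
    have D: "D \<noteq> 0"
      using sq[of k] dpos[of j] by (simp add: D_def)
    have pq: "D * p $ Inl k = c * f $ Inl k + s * g $ Inr k"
      "D * p $ Inr k = c * f $ Inr k - s * g $ Inl k"
      "D * q $ Inl k = c * g $ Inl k - s * f $ Inr k"
      "D * q $ Inr k = c * g $ Inr k + s * f $ Inl k"
      using jj kk[of k] by (auto simp: D_def c_def s_def q1 q2)
    have DD: "(Dhat *v z) $ Inl k = c / D * z $ Inl k" "(Dhat *v z) $ Inr k = c / D * z $ Inr k"
      "(Dbar *v z) $ Inl k = s / D * z $ Inl k" "(Dbar *v z) $ Inr k = s / D * z $ Inr k" for z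
      by (auto simp: Dhat_def Dbar_def D_def c_def s_def)
    show "p $ Inl k = (Dhat *v f + Dbar *v (J *v g)) $ Inl k"
      "p $ Inr k = (Dhat *v f + Dbar *v (J *v g)) $ Inr k"
      "q $ Inl k = (Dhat *v g - Dbar *v (J *v f)) $ Inl k"
      "q $ Inr k = (Dhat *v g - Dbar *v (J *v f)) $ Inr k"
      using D pq by (simp_all add: DD field_simps)
  qed
  then show "p = Dhat *v f + Dbar *v (J *v g)" "q = Dhat *v g - Dbar *v (J *v f)"
    by (simp_all add: sum_vec_eq_iff)
qed

section \<open>From the smooth maps to the derivative formulas\<close>

lemma infinitely_differentiable_on_has_derivative:
  assumes "infinitely_differentiable_on V U f" "x \<in> U"
  obtains f' where "(f has_derivative f') (at x within U)"
  using assms unfolding infinitely_differentiable_on_def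
  by (metis times_cont_differentiable_on.simps(2))

theorem theorem3p4:
  fixes A M :: "'n::{finite,linorder} mat2n"
    and j :: 'n
    and U :: "'n mat2n set"
    and u v :: "'n mat2n \<Rightarrow> 'n vec2n"
  defines "d \<equiv> symp_eigenvalue A"
  defines "Dhat \<equiv> double_diag
      (\<lambda>k. if k = j then - 1 / (4 * d j) else d k / ((d j)\<^sup>2 - (d k)\<^sup>2))"
  defines "Dbar \<equiv> double_diag
      (\<lambda>k. if k = j then 1 / (4 * d j) else d j / ((d j)\<^sup>2 - (d k)\<^sup>2))"
  assumes "A \<in> pos_def_matrices"
    and "simple_symp_eigenvalue A (d j)"
    and "openin (top_of_set pos_def_matrices) U" and "A \<in> U"
    and "infinitely_differentiable_on symmetric_matrices U (\<lambda>P. symp_eigenvalue P j)"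
    and "\<And>P. P \<in> U \<Longrightarrow> simple_symp_eigenvalue P (symp_eigenvalue P j)"
    and "infinitely_differentiable_on symmetric_matrices U u"
    and "infinitely_differentiable_on symmetric_matrices U v"
    and "\<And>P. P \<in> U \<Longrightarrow>
           normalised_symp_eigenvector_pair P (symp_eigenvalue P j) (u P) (v P)"
    and "\<And>P. P \<in> U \<Longrightarrow> u A \<bullet> (J *v u P) + v A \<bullet> (J *v v P) = 0"
    and "symplectic M" and "transpose M ** A ** M = double_diag d"
  shows "\<exists>Dd Du Dv.
    ((\<lambda>P. symp_eigenvalue P j) has_derivative Dd) (at A within U) \<and>
    (u has_derivative Du) (at A within U) \<and>
    (v has_derivative Dv) (at A within U) \<and>
    (\<forall>B\<in>symmetric_matrices.
       Dd B = (u A \<bullet> (B *v u A) + v A \<bullet> (B *v v A)) / 2 \<and>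
       Du B = (M ** Dhat ** transpose M ** B) *v u A + (M ** Dbar ** J ** transpose M ** B) *v v A \<and>
       Dv B = (M ** Dhat ** transpose M ** B) *v v A - (M ** Dbar ** J ** transpose M ** B) *v u A)"
proof -
  note A = assms(4) and simple = assms(5) and U = assms(6,7)
    and pair = assms(12) and gauge = assms(13) and M = assms(14) and MAM = assms(15)
  define \<delta> where "\<delta> = (\<lambda>P. symp_eigenvalue P j)"
  obtain Dd where Dd: "(\<delta> has_derivative Dd) (at A within U)"
    unfolding \<delta>_def using infinitely_differentiable_on_has_derivative[OF assms(8) U(2)] .
  obtain Du where Du: "(u has_derivative Du) (at A within U)"
    using infinitely_differentiable_on_has_derivative[OF assms(10) U(2)] .
  obtain Dv where Dv: "(v has_derivative Dv) (at A within U)"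
    using infinitely_differentiable_on_has_derivative[OF assms(11) U(2)] .
  have dj: "\<forall>k. k \<noteq> j \<longrightarrow> d k \<noteq> d j"
  proof -
    obtain i where "{i. d i = d j} = {i}"
      using simple unfolding simple_symp_eigenvalue_def d_def by (auto simp: card_1_singleton_iff)
    then have "d k = d j \<longleftrightarrow> k = i" for k
      by blast
    then show ?thesis
      by metis
  qed
  have \<delta>A: "\<delta> A = d j"
    by (simp add: \<delta>_def d_def)
  \<comment> \<open>Each identity is arranged with a constant right-hand side, ready for
    differentiation along \<open>B\<close>.\<close>
  have pairP: "P *v u P - \<delta> P *\<^sub>R (J *v v P) = 0" "P *v v P + \<delta> P *\<^sub>R (J *v u P) = 0"
    "u P \<bullet> (J *v v P) = 1" if "P \<in> U" for P
    using pair[OF that]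
    by (simp_all add: normalised_symp_eigenvector_pair_def symp_eigenvector_pair_def \<delta>_def)
  have D: "Dd B = (u A \<bullet> (B *v u A) + v A \<bullet> (B *v v A)) / 2 \<and>
       Du B = (M ** Dhat ** transpose M ** B) *v u A + (M ** Dbar ** J ** transpose M ** B) *v v A \<and>
       Dv B = (M ** Dhat ** transpose M ** B) *v v A - (M ** Dbar ** J ** transpose M ** B) *v u A"
    if B: "B \<in> symmetric_matrices" for B
  proof -
    note const = derivative_const_symmetric_direction[OF _ _ U B]
    note JDu = has_derivative_matrix_const[OF Du, of J] and JDv = has_derivative_matrix_const[OF Dv, of J]
    have 1: "A *v Du B + B *v u A - (d j *\<^sub>R (J *v Dv B) + Dd B *\<^sub>R (J *v v A)) = 0"
      using const[OF has_derivative_diff[OF has_derivative_matrix_vector[OF has_derivative_ident Du]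
          has_derivative_scaleR[OF Dd JDv]] pairP(1)] by (simp add: \<delta>A)
    have 2: "A *v Dv B + B *v v A + (d j *\<^sub>R (J *v Du B) + Dd B *\<^sub>R (J *v u A)) = 0"
      using const[OF has_derivative_add[OF has_derivative_matrix_vector[OF has_derivative_ident Dv]
          has_derivative_scaleR[OF Dd JDu]] pairP(2)] by (simp add: \<delta>A)
    have 3: "u A \<bullet> (J *v Dv B) + Du B \<bullet> (J *v v A) = 0"
      using const[OF has_derivative_inner[OF Du JDv] pairP(3)] by simp
    \<comment> \<open>In the gauge condition \<open>u A\<close> and \<open>v A\<close> are fixed, so
      only the second factors are differentiated.\<close>
    have 4: "u A \<bullet> (J *v Du B) + v A \<bullet> (J *v Dv B) = 0"
      using const[OF has_derivative_add[OF has_derivative_inner_right[OF JDu]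
          has_derivative_inner_right[OF JDv]] gauge] by simp
    \<comment> \<open>\<open>M\<close> is an arbitrary diagonalising symplectic matrix:
      \<open>u A\<close> and \<open>v A\<close> may differ from its columns, so general coordinates
      are introduced.\<close>
    have "\<exists>x. z = M *v x" for z
      using symplectic_surj[OF M] by blast
    then obtain x y p q where coords: "u A = M *v x" "v A = M *v y" "Du B = M *v p" "Dv B = M *v q"
      by meson
    define f g where "f = transpose M *v (B *v u A)" and "g = transpose M *v (B *v v A)"
    \<comment> \<open>Applying \<open>transpose M\<close> to the equations turns \<open>A\<close>
      into the diagonal matrix and leaves \<open>J\<close> unchanged, since \<open>M\<close> is
      symplectic.\<close>
    have MAMz: "transpose M *v (A *v (M *v z)) = double_diag d *v z" for z
      by (simp add: matrix_vector_mul_assoc matrix_mul_assoc flip: MAM)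
    note MJMz = symplectic_transpose_J[OF M]
    have inM: "(M *v z) \<bullet> (J *v (M *v w)) = z \<bullet> (J *v w)" for z w
      by (simp add: inner_matrix_transpose MJMz)
    note distribs = matrix_vector_right_distrib matrix_vector_mult_diff_distrib
      matrix_vector_mult_scaleR MAMz MJMz
    have x: "double_diag d *v x = d j *\<^sub>R (J *v y)"
      using arg_cong[OF pairP(1)[OF U(2)], of "(*v) (transpose M)"]
      by (simp add: coords distribs \<delta>A)
    have y: "double_diag d *v y = - d j *\<^sub>R (J *v x)"
      using arg_cong[OF pairP(2)[OF U(2)], of "(*v) (transpose M)"]
      by (simp add: coords distribs \<delta>A eq_neg_iff_add_eq_0)
    have p: "double_diag d *v p + f = Dd B *\<^sub>R (J *v y) + d j *\<^sub>R (J *v q)"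
      using arg_cong[OF 1, of "(*v) (transpose M)"]
      unfolding f_def by (simp add: coords distribs add.commute)
    have q: "double_diag d *v q + g = - (Dd B *\<^sub>R (J *v x) + d j *\<^sub>R (J *v p))"
      using arg_cong[OF 2, of "(*v) (transpose M)"]
      unfolding g_def coords distribs matrix_vector_mult_0_right
      by (simp only: eq_neg_iff_add_eq_0 add.commute)
    have n: "x \<bullet> (J *v y) = 1" "x \<bullet> (J *v q) + p \<bullet> (J *v y) = 0"
      "x \<bullet> (J *v p) + y \<bullet> (J *v q) = 0"
      using pairP(3)[OF U(2)] 3 4 by (simp_all add: coords inM)
    note perturbation = diagonal_perturbation[OF williamson_diagonal_pos[OF A M MAM] dj
        x y n(1) p q n(2,3), folded Dhat_def Dbar_def]
    have "x \<bullet> f = u A \<bullet> (B *v u A)" "y \<bullet> g = v A \<bullet> (B *v v A)"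
      by (simp_all only: f_def g_def coords(1,2) inner_matrix_transpose)
    moreover have "Du B = M *v (Dhat *v f) + M *v (Dbar *v (J *v g))"
      "Dv B = M *v (Dhat *v g) - M *v (Dbar *v (J *v f))"
      using perturbation(2,3)
      by (simp_all only: coords(3,4) matrix_vector_right_distrib matrix_vector_mult_diff_distrib)
    ultimately show ?thesis
      unfolding perturbation(1) f_def g_def by (simp only: matrix_vector_mul_assoc matrix_mul_assoc)
  qed
  show ?thesis
    using Dd Du Dv D unfolding \<delta>_def by blast
qed

end
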